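(* Let $V\subset\mathbb{R}^d$ be a finite point cloud, and let $f_{\mathbf{C}}\colon\mathcal{P}(V)\to\mathbb{R}_{\ge 0}$ and $f_{\mathbf{VR}}\colon\mathcal{P}(V)\to\mathbb{R}_{\ge 0}$ be the Čech filtration function and the Vietoris-Rips filtration function, respectively. Then $$f_{\mathbf{VR}}=2\cdot T_2f_{\mathbf{C}}.$$
   Context: $\mathcal{P}(V)$ is the power set of $V$ ordered by inclusion, and $\mathbb{R}_{\ge 0}$ is the poset of nonnegative reals; order-preserving functions are viewed as functors. $d(x,y)$ is Euclidean distance and $\overline{B_\varepsilon}(z)$ the closed ball of radius $\varepsilon$ about $z$. $f_{\mathbf{C}}(U)=\inf\{\varepsilon\ge 0:\exists z\in\mathbb{R}^d\text{ with }U\subseteq\overline{B_\varepsilon}(z)\}$ (the radius of $U$), and $f_{\mathbf{VR}}(U)=\max\{d(x,y):x,y\in U\}$ (the diameter of $U$); both take the value $0$ on the empty set. For a functor $f\colon\mathcal{P}(V)\to\mathbb{R}_{\ge 0}$, the codegree $n$ approximation $T_nf$ is the left Kan extension to $\mathcal{P}(V)$ of the restriction of $f$ to the subsets of cardinality $\le n$ (these are the elements of $\mathcal{P}(V)$ of join-dimension $\le n$); explicitly $T_nf(U)=\sup\{f(W):W\subseteq U,\ |W|\le n\}$. *)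

theory Defs
  imports "HOL-Analysis.Analysis"
begin

text \<open>
  A functor from the power set of \<open>V\<close> to the nonnegative reals is represented by a real-valued
  function on sets; only its values on subsets of \<open>V\<close> are relevant.
\<close>

definition filtration_fun :: "'a set \<Rightarrow> ('a set \<Rightarrow> real) \<Rightarrow> bool" where
  "filtration_fun V f \<longleftrightarrow> (\<forall>U\<in>Pow V. 0 \<le> f U) \<and> mono_on (Pow V) f"

text \<open>The centre \<open>z\<close> ranges over the whole ambient space, not just over \<open>U\<close>.\<close>

definition cech :: "'a::metric_space set \<Rightarrow> real" where
  "cech U = Inf {\<epsilon>. 0 \<le> \<epsilon> \<and> (\<exists>z. U \<subseteq> cball z \<epsilon>)}"

definition vietoris_rips :: "'a::metric_space set \<Rightarrow> real" where
  "vietoris_rips U = (if U = {} then 0 else Max {dist x y |x y. x \<in> U \<and> y \<in> U})"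

text \<open>
  The pointwise formula for the left Kan extension along the inclusion of the subsets of
  cardinality at most \<open>n\<close>; the universal property is proved in \<open>codegree_approx_is_left_kan\<close>.
  Finiteness of \<open>W\<close> is required since \<open>card\<close> is \<open>0\<close> on infinite sets.
\<close>

definition codegree_approx :: "nat \<Rightarrow> ('a set \<Rightarrow> real) \<Rightarrow> 'a set \<Rightarrow> real" where
  "codegree_approx n f U = Sup {f W |W. W \<subseteq> U \<and> finite W \<and> card W \<le> n}"

lemma codegree_approx_bdd:
  fixes f :: "'a set \<Rightarrow> real"
  assumes "finite U"
  shows "bdd_above {f W |W. W \<subseteq> U \<and> finite W \<and> card W \<le> n}"
proof (rule bdd_above_finite)
  have "{f W |W. W \<subseteq> U \<and> finite W \<and> card W \<le> n} \<subseteq> f ` Pow U"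
    by blast
  then show "finite {f W |W. W \<subseteq> U \<and> finite W \<and> card W \<le> n}"
    using assms finite_subset by blast
qed

lemma codegree_approx_upper:
  assumes "finite U" "W \<subseteq> U" "card W \<le> n"
  shows "f W \<le> codegree_approx n f U"
  unfolding codegree_approx_def
  using assms by (intro cSup_upper codegree_approx_bdd) (auto intro: finite_subset)

lemma codegree_approx_least:
  assumes "\<And>W. W \<subseteq> U \<Longrightarrow> finite W \<Longrightarrow> card W \<le> n \<Longrightarrow> f W \<le> c"
  shows "codegree_approx n f U \<le> c"
  unfolding codegree_approx_def
proof (rule cSup_least)
  have "f {} \<in> {f W |W. W \<subseteq> U \<and> finite W \<and> card W \<le> n}"
    by (intro CollectI exI[of _ "{}"]) simp
  then show "{f W |W. W \<subseteq> U \<and> finite W \<and> card W \<le> n} \<noteq> {}" by (metis empty_iff)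
qed (use assms in blast)

lemma filtration_fun_codegree_approx:
  assumes "finite V" "filtration_fun V f"
  shows "filtration_fun V (codegree_approx n f)"
  unfolding filtration_fun_def
proof (intro conjI ballI mono_onI)
  fix U assume "U \<in> Pow V"
  then have "f {} \<le> codegree_approx n f U" "0 \<le> f {}"
    using assms codegree_approx_upper[of U "{}" n f] finite_subset[of U V]
    by (simp_all add: filtration_fun_def)
  then show "0 \<le> codegree_approx n f U" by linarith
next
  fix U U' assume "U \<in> Pow V" "U' \<in> Pow V" "U \<subseteq> U'"
  then show "codegree_approx n f U \<le> codegree_approx n f U'"
    using assms(1) finite_subset[of U' V]
    by (intro codegree_approx_least codegree_approx_upper) auto
qed

text \<open>Between posets, a natural transformation is a pointwise inequality.\<close>

theorem codegree_approx_is_left_kan: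
  assumes "finite V" "filtration_fun V f" "filtration_fun V g"
  shows "(\<forall>U\<in>Pow V. codegree_approx n f U \<le> g U) \<longleftrightarrow>
         (\<forall>W\<in>Pow V. card W \<le> n \<longrightarrow> f W \<le> g W)"
proof (intro iffI ballI impI)
  fix W assume "\<forall>U\<in>Pow V. codegree_approx n f U \<le> g U" "W \<in> Pow V" "card W \<le> n"
  then show "f W \<le> g W"
    using codegree_approx_upper[of W W n f] assms(1) finite_subset[of W V] order_trans
    by (metis Pow_iff order_refl)
next
  fix U assume *: "\<forall>W\<in>Pow V. card W \<le> n \<longrightarrow> f W \<le> g W" and U: "U \<in> Pow V"
  show "codegree_approx n f U \<le> g U"
  proof (rule codegree_approx_least)
    fix W assume W: "W \<subseteq> U" "card W \<le> n"
    then have "f W \<le> g W" using * U by blast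
    also have "g W \<le> g U"
      using assms(3) U W mono_onD[of "Pow V" g W U] by (simp add: filtration_fun_def)
    finally show "f W \<le> g U" .
  qed
qed

lemma filtration_fun_cech:
  assumes "finite V"
  shows "filtration_fun V cech"
  unfolding filtration_fun_def
proof (intro conjI ballI mono_onI)
  have ne: "{\<epsilon>. 0 \<le> \<epsilon> \<and> (\<exists>z. U \<subseteq> cball z \<epsilon>)} \<noteq> {}" if "U \<in> Pow V" for U
  proof -
    have "bounded U" using that assms finite_subset finite_imp_bounded by blast
    then obtain z e where "\<forall>y\<in>U. dist z y \<le> e"
      unfolding bounded_def by blast
    then have "U \<subseteq> cball z (max 0 e)" by (force simp: subset_iff)
    then show ?thesis by (auto intro!: exI[of _ "max 0 e"])
  qed
  show "0 \<le> cech U" if "U \<in> Pow V" for U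
    unfolding cech_def by (rule cInf_greatest[OF ne[OF that]]) blast
  show "cech U \<le> cech U'" if "U \<in> Pow V" "U' \<in> Pow V" "U \<subseteq> U'" for U U'
    unfolding cech_def
    by (rule cInf_superset_mono[OF ne[OF that(2)]]) (use that(3) in \<open>auto intro!: bdd_belowI\<close>)
qed

lemma vietoris_rips_eq_diameter:
  assumes "finite U"
  shows "vietoris_rips U = diameter U"
proof (cases "U = {}")
  case False
  have eq: "{dist x y |x y. x \<in> U \<and> y \<in> U} = (\<lambda>(x,y). dist x y) ` (U \<times> U)"
    by auto
  show ?thesis
    using False assms unfolding vietoris_rips_def diameter_def eq
    by (simp add: cSup_eq_Max)
qed (simp add: vietoris_rips_def)

lemma filtration_fun_vietoris_rips:
  assumes "finite V"
  shows "filtration_fun V vietoris_rips"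
  unfolding filtration_fun_def
proof (intro conjI ballI mono_onI)
  show "0 \<le> vietoris_rips U" if "U \<in> Pow V" for U
    using that assms
    by (simp add: vietoris_rips_eq_diameter finite_subset diameter_ge_0 finite_imp_bounded)
  show "vietoris_rips U \<le> vietoris_rips U'" if "U \<in> Pow V" "U' \<in> Pow V" "U \<subseteq> U'" for U U'
    using that assms
    by (simp add: vietoris_rips_eq_diameter finite_subset diameter_subset finite_imp_bounded)
qed

end

theory Submission imports Defs begin

text \<open>The smallest ball containing two points is centred at their midpoint, so a pair has
  radius half its distance (\<open>cech_doubleton\<close>). The supremum defining
  \<open>codegree_approx 2 cech U\<close> therefore runs over half the pairwise distances, together
  with the value 0 of the empty set, and is half the diameter. Only midpoints and the triangle
  inequality enter, so the argument is carried out in any real normed space.\<close>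

lemma cech_empty: "cech {} = 0"
  by (simp add: cech_def flip: atLeast_def)

text \<open>The triangle inequality through the centre bounds every admissible radius from below,
  and the midpoint attains the bound. The admissible radii thus form a closed ray, whose infimum is
  its endpoint.\<close>

lemma cech_doubleton:
  fixes x y :: "'a::real_normed_vector"
  shows "cech {x, y} = dist x y / 2"
proof -
  have "{\<epsilon>. 0 \<le> \<epsilon> \<and> (\<exists>z. {x, y} \<subseteq> cball z \<epsilon>)} = {dist x y / 2..}"
  proof (intro equalityI subsetI)
    fix e assume "e \<in> {\<epsilon>. 0 \<le> \<epsilon> \<and> (\<exists>z. {x, y} \<subseteq> cball z \<epsilon>)}"
    then obtain z where "dist z x \<le> e" "dist z y \<le> e" by auto
    then show "e \<in> {dist x y / 2..}"
      using dist_triangle3[of x y z] by simp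
  next
    fix e assume e: "e \<in> {dist x y / 2..}"
    then have "{x, y} \<subseteq> cball (midpoint x y) e"
      by (simp add: dist_midpoint)
    moreover have "0 \<le> e"
      using e zero_le_dist[of x y] unfolding atLeast_iff by linarith
    ultimately show "e \<in> {\<epsilon>. 0 \<le> \<epsilon> \<and> (\<exists>z. {x, y} \<subseteq> cball z \<epsilon>)}" by blast
  qed
  then show ?thesis by (simp add: cech_def)
qed

text \<open>Singletons appear as the case \<open>x = y\<close>, so \<open>cech_doubleton\<close>
  covers them too.\<close>

lemma card_le_2_cases:
  assumes "finite W" "card W \<le> 2"
  obtains "W = {}" | x y where "W = {x, y}"
proof -
  consider "card W = 0" | "card W = 1" | "card W = 2" using assms(2) by linarith
  then show ?thesis
    using assms(1) that by cases (auto simp: card_1_singleton_iff card_2_iff)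
qed

lemma vietoris_rips_eq_codegree_approx_cech:
  fixes U :: "'a::real_normed_vector set"
  assumes "finite U"
  shows "vietoris_rips U = 2 * codegree_approx 2 cech U"
proof (rule antisym)
  have bdd: "bounded U" using assms by (rule finite_imp_bounded)
  have "codegree_approx 2 cech U \<le> diameter U / 2"
  proof (rule codegree_approx_least)
    fix W assume W: "W \<subseteq> U" and "finite W" "card W \<le> 2"
    from this(2,3) show "cech W \<le> diameter U / 2"
      by (cases rule: card_le_2_cases)
        (use W in \<open>auto simp: cech_empty cech_doubleton diameter_ge_0 diameter_bounded_bound bdd\<close>)
  qed
  then show "2 * codegree_approx 2 cech U \<le> vietoris_rips U"
    by (simp add: vietoris_rips_eq_diameter assms)
  have upper: "dist x y \<le> 2 * codegree_approx 2 cech U" if "x \<in> U" "y \<in> U" for x y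
  proof -
    have "card {x, y} \<le> 2" by (simp add: card_insert_if)
    then have "cech {x, y} \<le> codegree_approx 2 cech U"
      using that by (intro codegree_approx_upper assms) auto
    then show ?thesis by (simp add: cech_doubleton)
  qed
  \<comment> \<open>This serves \<open>U = {}\<close>, where \<open>upper\<close> is vacuous:
    \<open>diameter_le\<close> asks for a nonempty set or a nonnegative bound.\<close>
  have "0 \<le> 2 * codegree_approx 2 cech U"
    using codegree_approx_upper[OF assms, of "{}" 2 cech] by (simp add: cech_empty)
  then have "diameter U \<le> 2 * codegree_approx 2 cech U"
    using upper by (intro diameter_le) (auto simp flip: dist_norm)
  then show "vietoris_rips U \<le> 2 * codegree_approx 2 cech U"
    by (simp add: vietoris_rips_eq_diameter assms)
qed

theorem proposition7p6:
  fixes V :: "(real ^ 'd) set"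
  assumes "finite V"
  shows "\<forall>U\<in>Pow V. vietoris_rips U = 2 * codegree_approx 2 cech U"
  using assms by (auto intro: vietoris_rips_eq_codegree_approx_cech finite_subset)

end
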